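(* There is a triangle design in $\mathbb{F}_2^6$ which is invariant under a group of $\mathbb{F}_2$-linear automorphisms of $\mathbb{F}_2^6$ isomorphic to the multiplicative group $\mathbb{F}_{32}^*$.
   Context: For a vector space $V$ over $\mathbb{F}_2$, a triangle is a set $\{\langle a,b\rangle,\langle b,c\rangle,\langle c,a\rangle\}$ of three $2$-dimensional subspaces, with $a,b,c$ linearly independent. A triangle design in $V$ is a set of triangles such that every $2$-dimensional subspace of $V$ belongs to exactly one triangle of the set. A design is invariant under a group of linear maps if each map sends the set of triangles onto itself. *)

theory Defs
  imports
    "HOL-Analysis.Analysis"
    "HOL-Algebra.Multiplicative_Group"
    "HOL-Library.Z2"
    "HOL-Computational_Algebra.Polynomial"
begin

text \<open>The field \<open>\<bbbF>\<^sub>2\<close> is the type \<^typ>\<open>bit\<close>; the predicates \<open>vec.subspace\<close>, \<open>vec.span\<close>, \<open>vec.dim\<close>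
  and \<open>vec.independent\<close> refer to the scalar multiplication \<open>(*s)\<close> by elements of that field.\<close>

text \<open>The requirement \<open>distinct\<close> is needed because \<open>vec.independent\<close> speaks about the set
  \<open>{a, b, c}\<close> and not about the family \<open>a, b, c\<close>.\<close>

definition triangle :: "(bit ^ 'n) set set \<Rightarrow> bool" where
  "triangle t \<longleftrightarrow> (\<exists>a b c. distinct [a, b, c] \<and> vec.independent {a, b, c} \<and>
     t = {vec.span {a, b}, vec.span {b, c}, vec.span {c, a}})"

definition triangle_design :: "(bit ^ 'n) set set set \<Rightarrow> bool" where
  "triangle_design D \<longleftrightarrow> (\<forall>t\<in>D. triangle t) \<and>
     (\<forall>U. vec.subspace U \<and> vec.dim U = 2 \<longrightarrow> (\<exists>!t. t \<in> D \<and> U \<in> t))"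

definition GL :: "('a::field ^ 'n \<Rightarrow> 'a ^ 'n) monoid" where
  "GL = \<lparr>carrier = {f. Vector_Spaces.linear (*s) (*s) f \<and> bij f}, mult = (\<circ>), one = id\<rparr>"

text \<open>A map acts on points, hence on subspaces, hence on triangles, hence on sets of triangles.\<close>

definition invariant_under ::
  "(bit ^ 'n \<Rightarrow> bit ^ 'n) set \<Rightarrow> (bit ^ 'n) set set set \<Rightarrow> bool" where
  "invariant_under H D \<longleftrightarrow> (\<forall>g\<in>H. (\<lambda>t. (\<lambda>U. g ` U) ` t) ` D = D)"

lemma group_GL: "group (GL :: ('a::field ^ 'n \<Rightarrow> 'a ^ 'n) monoid)"
proof (rule groupI)
  fix f :: "'a ^ 'n \<Rightarrow> 'a ^ 'n"
  assume "f \<in> carrier GL"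
  then have f: "Vector_Spaces.linear (*s) (*s) f" "bij f"
    by (auto simp: GL_def)
  then obtain g where g: "Vector_Spaces.linear (*s) (*s) g" "g \<circ> f = id"
    using vec.linear_injective_left_inverse by (metis bij_is_inj)
  have "bij g"
    using f g by (metis bij_betw_comp_iff bij_id)
  with g show "\<exists>g\<in>carrier GL. g \<otimes>\<^bsub>GL\<^esub> f = \<one>\<^bsub>GL\<^esub>"
    by (auto simp: GL_def)
qed (auto simp: GL_def Vector_Spaces.linear_compose vec.linear_id bij_comp comp_assoc)

text \<open>A field with 32 elements exists: \<open>\<bbbF>\<^sub>2[X] / (X\<^sup>5 + X\<^sup>2 + 1)\<close>, with polynomials of degree
  less than 5 as representatives.\<close>

definition gf32_modulus :: "bit poly" where
  "gf32_modulus = [:1, 0, 1, 0, 0, 1:]"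

definition gf32 :: "bit poly ring" where
  "gf32 = \<lparr>carrier = {p. degree p < 5}, mult = (\<lambda>p q. (p * q) mod gf32_modulus), one = 1,
     zero = 0, add = (+)\<rparr>"

lemma degree_gf32_modulus: "degree gf32_modulus = 5"
  by (simp add: gf32_modulus_def)

lemma mod_gf32_modulus_id: "degree p < 5 \<Longrightarrow> p mod gf32_modulus = p"
  by (simp add: mod_poly_less degree_gf32_modulus)

lemma degree_mod_gf32_modulus: "degree (p mod gf32_modulus) < 5"
  using degree_mod_less'[of gf32_modulus p] degree_gf32_modulus
  by (cases "p mod gf32_modulus = 0") (auto simp: gf32_modulus_def)

lemma degree_less_5_iff:
  "degree p < 5 \<longleftrightarrow> (\<exists>a b c d e. p = [:a, b, c, d, e:])" for p :: "'a::zero poly"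
proof
  assume "degree p < 5"
  then have "p = [:poly.coeff p 0, poly.coeff p 1, poly.coeff p 2, poly.coeff p 3, poly.coeff p 4:]"
    by (intro poly_eqI) (auto simp: coeff_pCons coeff_eq_0 numeral_eq_Suc split: nat.splits)
  then show "\<exists>a b c d e. p = [:a, b, c, d, e:]"
    by blast
next
  assume "\<exists>a b c d e. p = [:a, b, c, d, e:]"
  then show "degree p < 5"
    by (auto simp: degree_pCons_eq_if)
qed

lemma order_gf32: "order gf32 = 32"
proof -
  define B where "B = {0, 1 :: bit}"
  define f where "f = (\<lambda>(a, b, c, d, e). [:a, b, c, d, e :: bit:])"
  have B: "x \<in> B" for x
    by (cases x) (auto simp: B_def)
  have "carrier gf32 = f ` (B \<times> B \<times> B \<times> B \<times> B)"
    by (auto simp: gf32_def degree_less_5_iff f_def B image_iff)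
  moreover have "inj_on f (B \<times> B \<times> B \<times> B \<times> B)"
    by (rule inj_onI) (auto simp: f_def)
  moreover have "card B = 2"
    by (simp add: B_def)
  ultimately show ?thesis
    by (simp add: order_def card_image card_cartesian_product)
qed

lemma gf32_inverse:
  assumes "degree p < 5" and "p \<noteq> 0"
  shows "\<exists>q. degree q < 5 \<and> (p * q) mod gf32_modulus = 1"
proof -
  define T :: "(bit poly \<times> bit poly \<times> bit poly) set" where
    "T = {([:1:], [:1:], 0), ([:0, 1:], [:0, 1, 0, 0, 1:], [:1:]),
     ([:1, 1:], [:0, 0, 1, 1, 1:], [:1:]), ([:0, 0, 1:], [:1, 0, 0, 1:], [:1:]),
     ([:1, 0, 1:], [:1, 1, 1, 0, 1:], [:0, 1:]), ([:0, 1, 1:], [:0, 1, 1, 1:], [:1:]),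
     ([:1, 1, 1:], [:0, 0, 1, 1:], [:1:]), ([:0, 0, 0, 1:], [:0, 1, 1, 0, 1:], [:1, 0, 1:]),
     ([:1, 0, 0, 1:], [:0, 0, 1:], [:1:]), ([:0, 1, 0, 1:], [:1, 0, 0, 1, 1:], [:1, 1, 1:]),
     ([:1, 1, 0, 1:], [:0, 0, 0, 0, 1:], [:1, 0, 1:]), ([:0, 0, 1, 1:], [:1, 1, 1:], [:1:]),
     ([:1, 0, 1, 1:], [:1, 1, 1, 1:], [:0, 1:]), ([:0, 1, 1, 1:], [:0, 1, 1:], [:1:]),
     ([:1, 1, 1, 1:], [:1, 0, 1, 1:], [:0, 1:]),
     ([:0, 0, 0, 0, 1:], [:1, 1, 0, 1:], [:1, 0, 1:]),
     ([:1, 0, 0, 0, 1:], [:0, 0, 0, 1, 1:], [:1, 0, 1, 1:]),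
     ([:0, 1, 0, 0, 1:], [:0, 1:], [:1:]),
     ([:1, 1, 0, 0, 1:], [:1, 0, 1, 1, 1:], [:0, 1, 1, 1:]),
     ([:0, 0, 1, 0, 1:], [:0, 1, 1, 1, 1:], [:1, 0, 1, 1:]),
     ([:1, 0, 1, 0, 1:], [:0, 1, 0, 1, 1:], [:1, 1, 1, 1:]),
     ([:0, 1, 1, 0, 1:], [:0, 0, 0, 1:], [:1, 0, 1:]),
     ([:1, 1, 1, 0, 1:], [:1, 0, 1:], [:0, 1:]),
     ([:0, 0, 0, 1, 1:], [:1, 0, 0, 0, 1:], [:1, 0, 1, 1:]),
     ([:1, 0, 0, 1, 1:], [:0, 1, 0, 1:], [:1, 1, 1:]),
     ([:0, 1, 0, 1, 1:], [:1, 0, 1, 0, 1:], [:1, 1, 1, 1:]),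
     ([:1, 1, 0, 1, 1:], [:1, 1, 1, 1, 1:], [:0, 0, 0, 1:]),
     ([:0, 0, 1, 1, 1:], [:1, 1:], [:1:]),
     ([:1, 0, 1, 1, 1:], [:1, 1, 0, 0, 1:], [:0, 1, 1, 1:]),
     ([:0, 1, 1, 1, 1:], [:0, 0, 1, 0, 1:], [:1, 0, 1, 1:]),
     ([:1, 1, 1, 1, 1:], [:1, 1, 0, 1, 1:], [:0, 0, 0, 1:])}"
  have T: "\<forall>(p, q, r) \<in> T. p * q = [:1:] + gf32_modulus * r \<and> degree q < 5"
    by (simp add: T_def gf32_modulus_def)
  have "p \<in> fst ` T"
  proof -
    from assms(1) obtain a b c d e where "p = [:a, b, c, d, e:]"
      unfolding degree_less_5_iff by blast
    with assms(2) show ?thesis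
      unfolding T_def by (cases a; cases b; cases c; cases d; cases e) simp_all
  qed
  then obtain q r where "(p, q, r) \<in> T"
    by force
  with T have "p * q = [:1:] + gf32_modulus * r" "degree q < 5"
    by auto
  then show ?thesis
    using mod_gf32_modulus_id[of 1] by (auto simp: pCons_one intro!: exI[of _ q])
qed

lemma field_gf32: "field gf32"
proof -
  have cr: "cring gf32"
  proof (intro cringI abelian_groupI comm_monoidI)
    fix x assume "x \<in> carrier gf32"
    then show "\<exists>y\<in>carrier gf32. y \<oplus>\<^bsub>gf32\<^esub> x = \<zero>\<^bsub>gf32\<^esub>"
      by (intro bexI[of _ "- x"]) (auto simp: gf32_def)
  qed (auto simp: gf32_def degree_add_less degree_mod_gf32_modulus mod_gf32_modulus_id
      mod_simps algebra_simps poly_mod_add_left)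
  show ?thesis
  proof (rule cring.cring_fieldI2[OF cr])
    fix p assume "p \<in> carrier gf32" "p \<noteq> \<zero>\<^bsub>gf32\<^esub>"
    with gf32_inverse[of p] show "\<exists>q\<in>carrier gf32. p \<otimes>\<^bsub>gf32\<^esub> q = \<one>\<^bsub>gf32\<^esub>"
      by (auto simp: gf32_def mult.commute)
  qed (simp add: gf32_def)
qed

end

theory Submission
  imports Defs
begin

text \<open>Identify \<open>\<bbbF>\<^sub>2\<^sup>6\<close> with \<open>\<bbbF>\<^sub>3\<^sub>2 \<oplus> \<bbbF>\<^sub>2\<close> and let \<open>\<sigma>\<close> be multiplication by a generator
  of \<open>\<bbbF>\<^sub>3\<^sub>2\<^sup>*\<close> on the first summand and the identity on the second. The 651 lines split
  into 21 regular orbits under the powers of \<open>\<sigma>\<close>, so it suffices to find 7 triangles whose 21 edges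
  represent every orbit. With points written as powers of the generator, this is a difference
  family condition modulo 31 on the edges. It yields that every line is covered; that no line is
  covered twice follows since the number of lines is at least \<open>31 \<cdot> 7 \<cdot> 3\<close>.\<close>

section \<open>Lines of a binary space\<close>

definition line :: "bit ^ 'n \<Rightarrow> bit ^ 'n \<Rightarrow> (bit ^ 'n) set" where
  "line a b = {0, a, b, a + b}"

lemma bit_vec_add_self [simp]: "a + a = 0" for a :: "bit ^ 'n"
  by (simp add: vec_eq_iff)

lemma bit_vec_add_self_left [simp]: "a + (a + b) = b" for a :: "bit ^ 'n"
  by (simp add: add.assoc [symmetric])

lemma bit_vec_minus [simp]: "a - b = a + b" for a :: "bit ^ 'n"
  by (simp add: vec_eq_iff)

lemma bit_vec_add_eq_0_iff [simp]: "a + b = 0 \<longleftrightarrow> a = b" for a :: "bit ^ 'n"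
  by (metis bit_vec_minus right_minus_eq)

lemma UNIV_bit: "UNIV = {0, 1 :: bit}"
  by (auto intro: bit.exhaust)

instance bit :: finite
  by standard (simp add: UNIV_bit)

lemma bit_all: "(\<forall>k::bit. P k) \<longleftrightarrow> P 0 \<and> P 1"
  by (metis bit.exhaust)

lemma bit_ex: "(\<exists>k::bit. P k) \<longleftrightarrow> P 0 \<or> P 1"
  by (metis bit.exhaust)

lemma span_pair_eq_line: "vec.span {a, b} = line a b" for a :: "bit ^ 'n"
proof -
  \<comment> \<open>In characteristic 2, this solves the equations left by
    \<open>vec.span_insert\<close> for \<open>x\<close>.\<close>
  have eq: "x + a = y \<longleftrightarrow> x = a + y" for x a y :: "bit ^ 'n"
    by (metis add.commute bit_vec_add_self_left)
  show ?thesis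
    by (auto simp: vec.span_insert bit_ex line_def eq)
qed

lemma independent_pair_iff:
  "vec.independent {a, b} \<and> a \<noteq> b \<longleftrightarrow> a \<noteq> 0 \<and> b \<noteq> 0 \<and> a \<noteq> b" for a :: "bit ^ 'n"
  by (auto simp: vec.independent_insert vec.span_insert bit_ex)

lemma triangleI:
  fixes a b c :: "bit ^ 'n"
  assumes "a \<noteq> 0" "b \<noteq> 0" "a \<noteq> b" "c \<notin> line a b"
  shows "triangle {line a b, line b c, line c a}"
proof -
  have "vec.independent (insert c {a, b})"
    using assms independent_pair_iff[of a b]
    by (simp only: vec.independent_insert span_pair_eq_line) simp
  then have "vec.independent {a, b, c}"
    by (simp add: insert_commute)
  moreover have "distinct [a, b, c]"
    using assms by (auto simp: line_def)
  ultimately show ?thesis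
    unfolding triangle_def span_pair_eq_line by blast
qed

definition lines :: "(bit ^ 'n) set set" where
  "lines = {line a b | a b. a \<noteq> 0 \<and> b \<noteq> 0 \<and> a \<noteq> b}"

lemma plane_in_lines:
  fixes U :: "(bit ^ 'n) set"
  assumes "vec.subspace U" "vec.dim U = 2"
  shows "U \<in> lines"
proof -
  obtain B where B: "B \<subseteq> U" "vec.independent B" "U \<subseteq> vec.span B" "card B = vec.dim U"
    using vec.basis_exists by blast
  then obtain a b where ab: "B = {a, b}" "a \<noteq> b"
    using assms(2) by (metis card_2_iff)
  have "vec.span B = U"
    using B assms(1) by (metis subset_antisym vec.span_minimal)
  with ab(1) have "U = line a b"
    by (simp add: span_pair_eq_line)
  moreover have "a \<noteq> 0 \<and> b \<noteq> 0 \<and> a \<noteq> b"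
    using ab B(2) independent_pair_iff[of a b] by simp
  ultimately show ?thesis
    unfolding lines_def by blast
qed

lemma line_eqI:
  assumes "x \<in> line a b" "y \<in> line a b" "x \<noteq> 0" "y \<noteq> 0" "x \<noteq> y"
  shows "line x y = line a b"
  using assms by (auto simp: line_def add.commute add.left_commute)

lemma line_in_lines: "a \<noteq> 0 \<Longrightarrow> b \<noteq> 0 \<Longrightarrow> a \<noteq> b \<Longrightarrow> line a b \<in> lines"
  by (auto simp: lines_def)

lemma linear_image_line:
  "Vector_Spaces.linear (*s) (*s) f \<Longrightarrow> f ` line a b = line (f a) (f b)"
  by (simp add: line_def vec.linear_add vec.linear_0)

text \<open>Double counting of ordered pairs of distinct nonzero vectors: each pair lies in the line
  it spans, and a line contains 6 such pairs.\<close>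

lemma card_lines_ge:
  "(2 ^ CARD('n) - 1) * (2 ^ CARD('n) - 2) \<le> 6 * card (lines :: (bit ^ 'n) set set)"
proof -
  let ?V = "UNIV - {0 :: bit ^ 'n}"
  let ?F = "\<lambda>U :: (bit ^ 'n) set. Sigma (U - {0}) (\<lambda>x. U - {0, x})"
  have "CARD(bit) = 2"
    by (simp add: UNIV_bit)
  then have V: "CARD(bit ^ 'n) = 2 ^ CARD('n)"
    by simp
  have "card (Sigma ?V (\<lambda>x. UNIV - {0, x})) = (\<Sum>x\<in>?V. 2 ^ CARD('n) - 2)"
    using V by (subst card_SigmaI) (auto intro!: sum.cong simp: card_Diff_subset)
  also have "\<dots> = (2 ^ CARD('n) - 1) * (2 ^ CARD('n) - 2)"
    using V by (simp add: card_Diff_subset)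
  finally have "(2 ^ CARD('n) - 1) * (2 ^ CARD('n) - 2)
      = card (Sigma ?V (\<lambda>x. UNIV - {0, x}))" ..
  also have "\<dots> \<le> card (\<Union>U\<in>lines. ?F U)"
  proof (rule card_mono)
    show "Sigma ?V (\<lambda>x. UNIV - {0, x}) \<subseteq> (\<Union>U\<in>lines. ?F U)"
    proof
      fix p assume "p \<in> Sigma ?V (\<lambda>x. UNIV - {0, x})"
      then have "fst p \<noteq> 0" "snd p \<noteq> 0" "fst p \<noteq> snd p"
        by auto
      then have "line (fst p) (snd p) \<in> lines" "p \<in> ?F (line (fst p) (snd p))"
        by (auto intro: line_in_lines) (cases p; auto simp: line_def)
      then show "p \<in> (\<Union>U\<in>lines. ?F U)"
        by (rule UN_I)
    qed
  qed simp
  also have "\<dots> \<le> (\<Sum>U\<in>lines. card (?F U))"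
    by (rule card_UN_le) simp
  also have "\<dots> \<le> (\<Sum>U\<in>(lines :: (bit ^ 'n) set set). 6)"
  proof (rule sum_mono)
    fix U :: "(bit ^ 'n) set"
    assume "U \<in> lines"
    then obtain a b where ab: "U = line a b" "a \<noteq> 0" "b \<noteq> 0" "a \<noteq> b"
      by (auto simp: lines_def)
    have U: "card U = 4" "finite U"
      using ab by (auto simp: line_def)
    have "card (U - {0, x}) = 2" if "x \<in> U - {0}" for x
      using that U ab(1) by (subst card_Diff_subset) (auto simp: line_def)
    moreover have "card (U - {0}) = 3"
      using U ab(1) by (subst card_Diff_subset) (auto simp: line_def)
    ultimately show "card (?F U) \<le> 6"
      using U by (subst card_SigmaI) auto
  qed
  finally show ?thesis
    by simp
qed

section \<open>Iterates of a map of finite order\<close>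

lemma nat_pow_GL: "f [^]\<^bsub>GL\<^esub> (n::nat) = f ^^ n"
  by (induction n) (simp_all add: GL_def nat_pow_def funpow_swap1 fun_eq_iff)

lemma funpow_mod:
  assumes "f ^^ n = id"
  shows "f ^^ (k mod n) = f ^^ k"
  by (metis assms comp_id funpow_add funpow_mult id_funpow mod_mult_div_eq)

text \<open>Because \<open>a\<close> has finite order, natural exponents reach inverses:
  \<open>(n - 1) * k\<close> serves as the exponent \<open>- k\<close>.\<close>

lemma subgroup_powers:
  assumes "group G" "a \<in> carrier G" "a [^]\<^bsub>G\<^esub> (n::nat) = \<one>\<^bsub>G\<^esub>" "n > 0"
  shows "subgroup (range (\<lambda>k::nat. a [^]\<^bsub>G\<^esub> k)) G"
proof -
  interpret group G by fact
  show ?thesis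
  proof (rule subgroupI)
    fix x assume "x \<in> range (\<lambda>k::nat. a [^]\<^bsub>G\<^esub> k)"
    then obtain k :: nat where x: "x = a [^]\<^bsub>G\<^esub> k" by auto
    have "a [^]\<^bsub>G\<^esub> ((n - 1) * k) \<otimes>\<^bsub>G\<^esub> x = a [^]\<^bsub>G\<^esub> ((n - 1) * k + k)"
      using assms(2) by (simp add: x nat_pow_mult)
    also have "(n - 1) * k + k = n * k"
      using assms(4) by (cases n) auto
    also have "a [^]\<^bsub>G\<^esub> (n * k) = \<one>\<^bsub>G\<^esub>"
      using assms(2,3) by (simp add: nat_pow_pow [symmetric])
    finally have "inv\<^bsub>G\<^esub> x = a [^]\<^bsub>G\<^esub> ((n - 1) * k)"
      using assms(2) x by (intro inv_equality) auto
    then show "inv\<^bsub>G\<^esub> x \<in> range (\<lambda>k::nat. a [^]\<^bsub>G\<^esub> k)"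
      by simp
  qed (use assms(2) in \<open>auto simp: nat_pow_mult\<close>)
qed

text \<open>The order of an element is the size of the subgroup it generates, and here the natural
  powers already fill the group.\<close>

lemma (in group) ord_generator:
  assumes "a \<in> carrier G" "carrier G = range (\<lambda>k::nat. a [^] k)"
  shows "ord a = order G"
proof -
  interpret H: subgroup "generate G {a}" G
    using assms(1) by (intro generate_is_subgroup) auto
  have "a [^] k \<in> generate G {a}" for k :: nat
    by (induction k) (auto intro: generate.incl)
  then have "generate G {a} = carrier G"
    using assms(2) H.subset by auto
  then show ?thesis
    by (simp add: generate_pow_card[OF assms(1)] order_def)
qed

text \<open>Whether two powers agree depends only on the exponents modulo the order of the
  generator. Equal orders thus make the map from powers of \<open>a\<close> to equal powers of
  \<open>b\<close> well defined and injective.\<close>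

lemma cyclic_groups_iso:
  assumes "group G" "group K" "a \<in> carrier G" "b \<in> carrier K"
    and G: "carrier G = range (\<lambda>k::nat. a [^]\<^bsub>G\<^esub> k)"
    and K: "carrier K = range (\<lambda>k::nat. b [^]\<^bsub>K\<^esub> k)"
    and ord: "group.ord G a = group.ord K b"
  shows "G \<cong> K"
proof -
  interpret G: group G by fact
  interpret K: group K by fact
  have eq: "a [^]\<^bsub>G\<^esub> m = a [^]\<^bsub>G\<^esub> n \<longleftrightarrow> b [^]\<^bsub>K\<^esub> m = b [^]\<^bsub>K\<^esub> n" for m n :: nat
    using G.int_pow_eq[OF assms(3), of "int m" "int n"]
      K.int_pow_eq[OF assms(4), of "int m" "int n"] ord
    by (simp add: int_pow_int)
  define f where "f x = b [^]\<^bsub>K\<^esub> (SOME k::nat. a [^]\<^bsub>G\<^esub> k = x)" for x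
  have f: "f (a [^]\<^bsub>G\<^esub> k) = b [^]\<^bsub>K\<^esub> k" for k :: nat
    unfolding f_def eq [symmetric] by (rule someI) simp
  have "f \<in> hom G K"
  proof (rule homI)
    fix x y assume "x \<in> carrier G" "y \<in> carrier G"
    then obtain k l :: nat where "x = a [^]\<^bsub>G\<^esub> k" "y = a [^]\<^bsub>G\<^esub> l"
      by (auto simp: G)
    then show "f (x \<otimes>\<^bsub>G\<^esub> y) = f x \<otimes>\<^bsub>K\<^esub> f y"
      using assms(3,4) by (simp add: f G.nat_pow_mult K.nat_pow_mult)
  qed (auto simp: G f assms(4))
  moreover have "inj_on f (carrier G)"
    by (auto simp: G f eq intro!: inj_onI)
  moreover have "f ` carrier G = carrier K"
    by (auto simp: G K f image_image)
  ultimately show ?thesis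
    by (auto simp: is_iso_def iso_def bij_betw_def)
qed

section \<open>The field of order 32 plus a fixed coordinate\<close>

lemma exhaust_6: "x = 0 \<or> x = 1 \<or> x = 2 \<or> x = 3 \<or> x = 4 \<or> x = 5" for x :: 6
proof (induct x)
  case (of_int z)
  then have "z = 0 \<or> z = 1 \<or> z = 2 \<or> z = 3 \<or> z = 4 \<or> z = 5" by fastforce
  then show ?case by auto
qed

lemma forall_6: "(\<forall>i::6. P i) \<longleftrightarrow> P 0 \<and> P 1 \<and> P 2 \<and> P 3 \<and> P 4 \<and> P 5"
  by (metis exhaust_6)

text \<open>Entries \<open>a\<close> to \<open>e\<close> are the coefficients of 1, X, ..., X^4, so
  that coordinate i belongs to X^i; \<open>f\<close> is the summand of order 2.\<close>

definition vec6 :: "bit \<Rightarrow> bit \<Rightarrow> bit \<Rightarrow> bit \<Rightarrow> bit \<Rightarrow> bit \<Rightarrow> bit ^ 6" where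
  "vec6 a b c d e f = (\<chi> i. if i = 0 then a else if i = 1 then b else if i = 2 then c
     else if i = 3 then d else if i = 4 then e else f)"

lemma vec6_nth [simp]:
  "vec6 a b c d e f $ 0 = a" "vec6 a b c d e f $ 1 = b" "vec6 a b c d e f $ 2 = c"
  "vec6 a b c d e f $ 3 = d" "vec6 a b c d e f $ 4 = e" "vec6 a b c d e f $ 5 = f"
  by (simp_all add: vec6_def)

lemma vec6_eq_iff [simp]:
  "vec6 a b c d e f = vec6 a' b' c' d' e' f' \<longleftrightarrow>
     a = a' \<and> b = b' \<and> c = c' \<and> d = d' \<and> e = e' \<and> f = f'"
  by (simp add: vec_eq_iff forall_6)

lemma vec6_add [simp]:
  "vec6 a b c d e f + vec6 a' b' c' d' e' f' =
     vec6 (a + a') (b + b') (c + c') (d + d') (e + e') (f + f')"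
  by (simp add: vec_eq_iff forall_6)

lemma zero_vec6: "0 = vec6 0 0 0 0 0 0"
  by (simp add: vec_eq_iff forall_6)

lemma vec6_cases: obtains a b c d e f where "x = vec6 a b c d e f"
proof
  show "x = vec6 (x $ 0) (x $ 1) (x $ 2) (x $ 3) (x $ 4) (x $ 5)"
    by (simp add: vec_eq_iff forall_6)
qed

text \<open>Multiplication by \<open>X\<close> modulo \<open>X\<^sup>5 + X\<^sup>2 + 1\<close>; the coordinate \<open>5\<close> is fixed.\<close>

definition sigma :: "bit ^ 6 \<Rightarrow> bit ^ 6" where
  "sigma x = vec6 (x $ 4) (x $ 0) (x $ 1 + x $ 4) (x $ 2) (x $ 3) (x $ 5)"

lemma sigma_vec6 [simp]: "sigma (vec6 a b c d e f) = vec6 e a (b + e) c d f"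
  by (simp add: sigma_def)

lemma linear_sigma: "Vector_Spaces.linear (*s) (*s) sigma"
proof -
  have "sigma (x + y) = sigma x + sigma y" for x y
    by (cases "x $ 1"; cases "x $ 4"; cases "y $ 1"; cases "y $ 4")
      (simp_all add: sigma_def)
  moreover have "sigma (c *s x) = c *s sigma x" for c x
    by (cases c) (simp_all add: sigma_def vec_eq_iff forall_6)
  ultimately show ?thesis
    by (simp add: Vector_Spaces.linear_iff vec.vector_space_axioms)
qed

text \<open>The nonzero residues modulo X^5 + X^2 + 1 form a group of order 31. The check runs over
  the 32 values of the first five coordinates; \<open>f\<close> stays symbolic.\<close>

lemma sigma_order: "sigma ^^ 31 = id"
proof
  fix x
  obtain a b c d e f where "x = vec6 a b c d e f"
    by (rule vec6_cases)
  then show "(sigma ^^ 31) x = id x"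
    by (cases a; cases b; cases c; cases d; cases e) (simp_all add: eval_nat_numeral)
qed

text \<open>The only nonzero fixed point of \<open>sigma\<close>. Every other nonzero vector is some
  \<open>pt i s\<close>.\<close>

definition apex :: "bit ^ 6" where
  "apex = vec6 0 0 0 0 0 1"

text \<open>The point (X^i, s): \<open>sigma\<close> raises the exponent by one and keeps
  \<open>s\<close>.\<close>

definition pt :: "nat \<Rightarrow> bit \<Rightarrow> bit ^ 6" where
  "pt i s = (sigma ^^ i) (vec6 1 0 0 0 0 s)"

lemma sigma_funpow_pt: "(sigma ^^ k) (pt i s) = pt (k + i) s"
  by (simp add: pt_def funpow_add)

lemma sigma_funpow_mod: "sigma ^^ (k mod 31) = sigma ^^ k"
  by (rule funpow_mod [OF sigma_order])

lemma pt_mod: "pt (i mod 31) s = pt i s"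
  by (simp add: pt_def sigma_funpow_mod)

text \<open>A table of discrete logarithms with which simp computes. \<open>Suc 0\<close> is the
  form into which simp turns the exponent 1.\<close>

lemma pt_table:
  "pt 0 s = vec6 1 0 0 0 0 s" "pt (Suc 0) s = vec6 0 1 0 0 0 s"
  "pt 2 s = vec6 0 0 1 0 0 s" "pt 3 s = vec6 0 0 0 1 0 s"
  "pt 4 s = vec6 0 0 0 0 1 s" "pt 5 s = vec6 1 0 1 0 0 s"
  "pt 6 s = vec6 0 1 0 1 0 s" "pt 7 s = vec6 0 0 1 0 1 s"
  "pt 8 s = vec6 1 0 1 1 0 s" "pt 9 s = vec6 0 1 0 1 1 s"
  "pt 10 s = vec6 1 0 0 0 1 s" "pt 11 s = vec6 1 1 1 0 0 s"
  "pt 12 s = vec6 0 1 1 1 0 s" "pt 13 s = vec6 0 0 1 1 1 s"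
  "pt 14 s = vec6 1 0 1 1 1 s" "pt 15 s = vec6 1 1 1 1 1 s"
  "pt 16 s = vec6 1 1 0 1 1 s" "pt 17 s = vec6 1 1 0 0 1 s"
  "pt 18 s = vec6 1 1 0 0 0 s" "pt 19 s = vec6 0 1 1 0 0 s"
  "pt 20 s = vec6 0 0 1 1 0 s" "pt 21 s = vec6 0 0 0 1 1 s"
  "pt 22 s = vec6 1 0 1 0 1 s" "pt 23 s = vec6 1 1 1 1 0 s"
  "pt 24 s = vec6 0 1 1 1 1 s" "pt 25 s = vec6 1 0 0 1 1 s"
  "pt 26 s = vec6 1 1 1 0 1 s" "pt 27 s = vec6 1 1 0 1 0 s"
  "pt 28 s = vec6 0 1 1 0 1 s" "pt 29 s = vec6 1 0 0 1 0 s"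
  "pt 30 s = vec6 0 1 0 0 1 s"
  by (simp_all add: pt_def numeral_eq_Suc)

section \<open>The base triangles\<close>

text \<open>The vertices of the 7 base triangles, found by a computer search.\<close>

definition base :: "(bit ^ 6) list list" where
  "base = [[pt 0 1, pt 0 0, pt 1 0], [pt 0 1, pt 18 0, pt 20 0], [pt 0 1, pt 2 0, pt 29 0],
     [pt 0 1, pt 5 0, pt 27 0], [pt 0 1, pt 19 0, pt 10 1], [pt 0 1, pt 11 0, pt 4 1],
     [pt 0 0, pt 8 0, pt 9 1]]"

definition edge :: "nat \<Rightarrow> nat \<Rightarrow> (bit ^ 6) set" where
  "edge i j = line (base ! i ! j) (base ! i ! (Suc j mod 3))"

text \<open>Taking a triple turns covering and uniqueness into statements about the image of
  \<open>params\<close> and injectivity on it.\<close>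

definition orbit_edge :: "nat \<times> nat \<times> nat \<Rightarrow> (bit ^ 6) set" where
  "orbit_edge = (\<lambda>(k, i, j). (sigma ^^ k) ` edge i j)"

text \<open>The three points of each base edge, \<open>(a, s)\<close> standing for \<open>pt a s\<close>. The edge \<open>(0, 0)\<close> is missing
  as its third point is \<open>apex\<close>.\<close>

definition edge_points :: "(nat \<times> nat \<times> (nat \<times> bit) list) list" where
  "edge_points =
  [(0, 1, [(0, 0), (1, 0), (18, 0)]), (0, 2, [(1, 0), (0, 1), (18, 1)]),
   (1, 0, [(0, 1), (18, 0), (1, 1)]), (1, 1, [(18, 0), (20, 0), (23, 0)]),
   (1, 2, [(20, 0), (0, 1), (8, 1)]), (2, 0, [(0, 1), (2, 0), (5, 1)]),
   (2, 1, [(2, 0), (29, 0), (8, 0)]), (2, 2, [(29, 0), (0, 1), (3, 1)]),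
   (3, 0, [(0, 1), (5, 0), (2, 1)]), (3, 1, [(5, 0), (27, 0), (12, 0)]),
   (3, 2, [(27, 0), (0, 1), (6, 1)]), (4, 0, [(0, 1), (19, 0), (11, 1)]),
   (4, 1, [(19, 0), (10, 1), (26, 1)]), (4, 2, [(10, 1), (0, 1), (4, 0)]),
   (5, 0, [(0, 1), (11, 0), (19, 1)]), (5, 1, [(11, 0), (4, 1), (26, 1)]),
   (5, 2, [(4, 1), (0, 1), (10, 0)]), (6, 0, [(0, 0), (8, 0), (20, 0)]),
   (6, 1, [(8, 0), (9, 1), (26, 1)]), (6, 2, [(9, 1), (0, 0), (16, 1)])]"

lemma edge_points_mem:
  assumes "(i, j, L) \<in> set edge_points" "(a, s) \<in> set L"
  shows "i < 7" "j < 3" "pt a s \<in> edge i j"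
proof -
  have "\<forall>(i, j, L)\<in>set edge_points. i < 7 \<and> j < 3 \<and> (\<forall>(a, s)\<in>set L. pt a s \<in> edge i j)"
    by (simp add: edge_points_def edge_def base_def pt_table line_def)
  then show "i < 7" "j < 3" "pt a s \<in> edge i j"
    using assms by fastforce+
qed

lemma lessThan_31: "{..<31 :: nat} = {30, 29, 28, 27, 26, 25, 24, 23, 22, 21, 20, 19, 18, 17, 16,
    15, 14, 13, 12, 11, 10, 9, 8, 7, 6, 5, 4, 3, 2, 1, 0}"
  by (simp add: lessThan_nat_numeral lessThan_Suc)

text \<open>Here \<open>b + 30 * a\<close> is the difference \<open>b - a\<close> modulo 31.\<close>

definition differences :: "(nat \<times> bit \<times> bit) list" where
  "differences = concat (map (\<lambda>(i, j, L).
     concat (map (\<lambda>(a, s). map (\<lambda>(b, t). ((b + 30 * a) mod 31, s, t)) L) L)) edge_points)"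

text \<open>Each of the 20 listed edges gives 6 ordered pairs of distinct points, 120 in all, which
  just matches the 30 * 4 triples to be hit.\<close>

lemma differences: "\<forall>d\<in>{..<31}. d \<noteq> 0 \<longrightarrow> (\<forall>s t. (d, s, t) \<in> set differences)"
  by (simp add: differences_def edge_points_def bit_all lessThan_31)

lemma difference_family:
  assumes "0 < d" "d < 31"
  obtains i j L a b where "(i, j, L) \<in> set edge_points" "(a, s) \<in> set L" "(b, t) \<in> set L"
    "(b + 30 * a) mod 31 = d"
proof -
  have "(d, s, t) \<in> set differences"
    using assms differences by simp
  then show ?thesis
    unfolding differences_def using that by fastforce
qed

lemma point_cases:
  assumes "x \<noteq> 0" "x \<noteq> apex"
  obtains i s where "i < 31" "x = pt i s"
proof -
  obtain a b c d e f where x: "x = vec6 a b c d e f"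
    by (rule vec6_cases)
  then have "\<exists>i\<in>{..<31}. x = pt i f"
    using assms
    by (cases a; cases b; cases c; cases d; cases e)
      (auto simp: lessThan_31 pt_table zero_vec6 apex_def)
  with that show ?thesis
    by blast
qed

lemma linear_sigma_funpow: "Vector_Spaces.linear (*s) (*s) (sigma ^^ k)"
  by (induction k)
    (simp_all only: funpow.simps vec.linear_id Vector_Spaces.linear_compose linear_sigma)

lemma bij_sigma_funpow: "bij (sigma ^^ k)"
proof -
  \<comment> \<open>Since \<open>sigma\<close> has period 31, \<open>30 * k\<close> steps undo
    \<open>k\<close> steps.\<close>
  have "(sigma ^^ (30 * k)) \<circ> (sigma ^^ k) = id" "(sigma ^^ k) \<circ> (sigma ^^ (30 * k)) = id"
    using sigma_funpow_mod[of "31 * k"] by (simp_all flip: funpow_add)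
  then show ?thesis
    by (rule o_bij)
qed

lemma pt_nonzero: "pt i s \<noteq> 0"
proof -
  have "pt i s \<noteq> (sigma ^^ i) 0"
    unfolding pt_def by (simp add: inj_eq[OF bij_is_inj[OF bij_sigma_funpow]] zero_vec6)
  then show ?thesis
    by (simp add: vec.linear_0[OF linear_sigma_funpow])
qed

text \<open>A line has three nonzero points and at most one of them is \<open>apex\<close>; two
  others remain.\<close>

lemma line_two_points:
  assumes "U \<in> lines"
  obtains i s j t where "i < 31" "j < 31" "pt i s \<noteq> pt j t" "U = line (pt i s) (pt j t)"
proof -
  obtain x y where xy: "U = line x y" "x \<noteq> 0" "y \<noteq> 0" "x \<noteq> y"
    using assms by (auto simp: lines_def)
  have "\<exists>x' y'. U = line x' y' \<and> x' \<noteq> 0 \<and> y' \<noteq> 0 \<and> x' \<noteq> y' \<and> x' \<noteq> apex \<and> y' \<noteq> apex"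
  proof -
    have "apex \<noteq> x + y" if "x = apex \<or> y = apex"
      using that xy bit_vec_add_self_left by (metis add.commute add_0_right)
    moreover have "U = line y (x + y)" "U = line x (x + y)" "y \<noteq> x + y" "x \<noteq> x + y"
      using xy by (auto simp: line_def add.commute add.left_commute)
    ultimately show ?thesis
      using xy by (metis bit_vec_add_eq_0_iff)
  qed
  then show ?thesis
    by (metis that point_cases)
qed

section \<open>Every line occurs exactly once among the shifted base edges\<close>

definition params :: "(nat \<times> nat \<times> nat) set" where
  "params = {..<31} \<times> {..<7} \<times> {..<3}"

text \<open>If the exponents of two points of the line agree, its third point is \<open>apex\<close>
  and it is a shift of the edge (0, 0). Otherwise the difference family supplies a base edge with
  the same difference and the same \<open>s\<close>, \<open>t\<close>, and a shift moves it onto the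
  line.\<close>

lemma lines_covered: "lines \<subseteq> orbit_edge ` params"
proof
  fix U :: "(bit ^ 6) set"
  assume "U \<in> lines"
  then obtain i s j t where ij: "i < 31" "j < 31" "pt i s \<noteq> pt j t" "U = line (pt i s) (pt j t)"
    by (rule line_two_points)
  \<comment> \<open>Two distinct nonzero common points force two lines to agree, so only two
    memberships remain to be checked.\<close>
  have *: "U \<in> orbit_edge ` params"
    if "i' < 7" "j' < 3" "pt i s \<in> (sigma ^^ k) ` edge i' j'" "pt j t \<in> (sigma ^^ k) ` edge i' j'"
    for k i' j'
  proof -
    have "U = (sigma ^^ k) ` edge i' j'"
      unfolding ij(4) edge_def linear_image_line[OF linear_sigma_funpow]
      by (rule line_eqI) (use that(3,4) ij pt_nonzero in
          \<open>simp_all add: edge_def linear_image_line[OF linear_sigma_funpow]\<close>)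
    then have "U = orbit_edge (k mod 31, i', j')"
      by (simp add: orbit_edge_def sigma_funpow_mod)
    then show ?thesis
      using that by (auto simp: params_def)
  qed
  show "U \<in> orbit_edge ` params"
  proof (cases "i = j")
    case True
    have "pt 0 u \<in> edge 0 0" for u
      by (cases u) (simp_all add: edge_def base_def line_def)
    then have "pt i u \<in> (sigma ^^ i) ` edge 0 0" for u
      using sigma_funpow_pt[of i 0 u] by (metis add_0_right imageI)
    then show ?thesis
      using True by (intro *[of 0 0 i]) auto
  next
    case False
    \<comment> \<open>Adding 31 keeps the subtraction of naturals from truncating.\<close>
    define d where "d = (j + 31 - i) mod 31"
    have d: "(i + d) mod 31 = j"
      using ij(1,2) by (simp add: d_def mod_simps)
    then have "0 < d" "d < 31"
      using False ij(1) by (auto simp: d_def intro: gr0I)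
    then obtain i' j' L a b where L: "(i', j', L) \<in> set edge_points" "(a, s) \<in> set L"
        "(b, t) \<in> set L" "(b + 30 * a) mod 31 = d"
      by (rule difference_family)
    \<comment> \<open>As 30 is -1 modulo 31, this is the shift i - a, taking \<open>pt a s\<close>
      to \<open>pt i s\<close>.\<close>
    define k where "k = i + 30 * a"
    have "(k + a) mod 31 = i"
      using ij(1) by (simp add: k_def)
    moreover have "(k + b) mod 31 = j"
    proof -
      have "(k + b) mod 31 = (i + (b + 30 * a) mod 31) mod 31"
        by (simp add: k_def mod_simps algebra_simps)
      then show ?thesis
        using d L(4) by simp
    qed
    ultimately have "pt i s = (sigma ^^ k) (pt a s)" "pt j t = (sigma ^^ k) (pt b t)"
      by (metis sigma_funpow_pt pt_mod)+
    with edge_points_mem[OF L(1)] L(2,3) show ?thesis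
      by (intro *[of i' j' k]) auto
  qed
qed

lemma inj_on_orbit_edge: "inj_on orbit_edge params"
proof (rule eq_card_imp_inj_on)
  have params: "finite params" "card params = 651"
    by (simp_all add: params_def card_cartesian_product)
  then show "finite params" by simp
  \<comment> \<open>Here 63 * 62 = 6 * 651, and 651 = 31 * 7 * 3 is also the size of
    \<open>params\<close>.\<close>
  have "651 \<le> card (lines :: (bit ^ 6) set set)"
    using card_lines_ge[where 'n = 6] by simp
  also have "\<dots> \<le> card (orbit_edge ` params)"
    using params lines_covered by (intro card_mono) auto
  finally show "card (orbit_edge ` params) = card params"
    using card_image_le[OF params(1), of orbit_edge] params(2) by simp
qed

section \<open>The design and its invariance\<close>

definition orbit_triangle :: "nat \<Rightarrow> nat \<Rightarrow> (bit ^ 6) set set" where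
  "orbit_triangle k i = (\<lambda>j. orbit_edge (k, i, j)) ` {..<3}"

text \<open>Leaving \<open>k\<close> unbounded makes closure under shifts immediate; the triangles
  repeat with period 31 in \<open>k\<close>.\<close>

definition design :: "(bit ^ 6) set set set" where
  "design = {orbit_triangle k i | k i. i < 7}"

lemma orbit_triangle_mod: "orbit_triangle (k mod 31) i = orbit_triangle k i"
  by (simp add: orbit_triangle_def orbit_edge_def sigma_funpow_mod)

lemma image_orbit_triangle:
  "(\<lambda>U. (sigma ^^ m) ` U) ` orbit_triangle k i = orbit_triangle (m + k) i"
  by (simp add: orbit_triangle_def orbit_edge_def image_image funpow_add)

text \<open>Independence of the vertices is computed for the seven base triangles, and the injective
  linear map \<open>sigma ^^ k\<close> preserves it.\<close>

lemma triangle_orbit_triangle: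
  assumes "i < 7"
  shows "triangle (orbit_triangle k i)"
proof -
  define a b c where abc: "a = base ! i ! 0" "b = base ! i ! 1" "c = base ! i ! 2"
  define h where "h = sigma ^^ k"
  have h: "Vector_Spaces.linear (*s) (*s) h" "inj h"
    by (simp_all add: h_def linear_sigma_funpow bij_is_inj[OF bij_sigma_funpow])
  have "i \<in> {0, 1, 2, 3, 4, 5, 6}"
    using assms by auto
  then have abc_indep: "a \<noteq> 0 \<and> b \<noteq> 0 \<and> a \<noteq> b \<and> c \<notin> line a b"
    unfolding abc
    by (elim insertE emptyE; simp add: base_def pt_table zero_vec6 line_def)
  have h_eq_0: "h x = 0 \<longleftrightarrow> x = 0" for x
    using h by (metis injD vec.linear_0)
  have "h c \<notin> line (h a) (h b)"
    using abc_indep h by (simp add: inj_image_mem_iff flip: linear_image_line)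
  then have "h a \<noteq> 0" "h b \<noteq> 0" "h a \<noteq> h b" "h c \<notin> line (h a) (h b)"
    using abc_indep h by (simp_all add: h_eq_0 inj_eq)
  then have "triangle {line (h a) (h b), line (h b) (h c), line (h c) (h a)}"
    by (rule triangleI)
  also have "{line (h a) (h b), line (h b) (h c), line (h c) (h a)} = orbit_triangle k i"
  proof -
    have "orbit_edge (k, i, 0) = line (h a) (h b)" "orbit_edge (k, i, 1) = line (h b) (h c)"
        "orbit_edge (k, i, 2) = line (h c) (h a)"
      by (simp_all add: orbit_edge_def edge_def abc linear_image_line[OF h(1)] flip: h_def)
        (simp_all flip: numeral_2_eq_2)
    moreover have "{..<3} = {0, 1, 2 :: nat}"
      by auto
    ultimately show ?thesis
      unfolding orbit_triangle_def by simp
  qed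
  finally show ?thesis .
qed

text \<open>Existence is \<open>lines_covered\<close>. For uniqueness,
  \<open>inj_on_orbit_edge\<close> recovers the parameters of an edge from the line, and these fix
  the triangle.\<close>

lemma triangle_design_design: "triangle_design design"
  unfolding triangle_design_def
proof (intro conjI ballI allI impI)
  fix t assume "t \<in> design"
  then show "triangle t"
    by (auto simp: design_def triangle_orbit_triangle)
next
  fix U :: "(bit ^ 6) set"
  assume "vec.subspace U \<and> vec.dim U = 2"
  then have "U \<in> orbit_edge ` params"
    using plane_in_lines lines_covered by blast
  then obtain k i j where U: "U = orbit_edge (k, i, j)" "(k, i, j) \<in> params"
    by auto
  show "\<exists>!t. t \<in> design \<and> U \<in> t"
  proof (intro ex1I conjI)
    show "orbit_triangle k i \<in> design" "U \<in> orbit_triangle k i"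
      using U by (auto simp: design_def orbit_triangle_def params_def)
  next
    fix t assume t: "t \<in> design \<and> U \<in> t"
    then obtain l i' where l: "i' < 7" "t = orbit_triangle (l mod 31) i'"
      unfolding design_def orbit_triangle_mod by blast
    with t obtain j' where j': "j' < 3" "U = orbit_edge (l mod 31, i', j')"
      by (auto simp: orbit_triangle_def)
    with l have "(l mod 31, i', j') = (k, i, j)"
      by (intro inj_onD[OF inj_on_orbit_edge]) (use U in \<open>auto simp: params_def\<close>)
    with l show "t = orbit_triangle k i"
      by simp
  qed
qed

lemma invariant_under_design: "invariant_under (range (\<lambda>m. sigma ^^ m)) design"
  unfolding invariant_under_def
proof
  fix g assume "g \<in> range (\<lambda>m. sigma ^^ m)"
  then obtain m where g: "g = sigma ^^ m"
    by auto
  let ?act = "\<lambda>t. (\<lambda>U. g ` U) ` t"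
  have sub: "?act t \<in> design" if "t \<in> design" for t
    using that image_orbit_triangle unfolding design_def g by blast
  have "t \<in> ?act ` design" if t_design: "t \<in> design" for t
  proof -
    obtain k i where t: "t = orbit_triangle k i" "i < 7"
      using t_design unfolding design_def by blast
    \<comment> \<open>The preimage of \<open>t\<close> is its shift by \<open>30 * m\<close>, which
      acts as the shift by -m.\<close>
    have "?act (orbit_triangle (30 * m + k) i) = orbit_triangle (k + 31 * m) i"
      by (simp add: g image_orbit_triangle algebra_simps)
    also have "\<dots> = t"
      using orbit_triangle_mod[of "k + 31 * m" i] orbit_triangle_mod[of k i] t by simp
    finally show ?thesis
      using t(2) by (intro image_eqI[of _ _ "orbit_triangle (30 * m + k) i"])
        (auto simp: design_def)
  qed
  with sub show "?act ` design = design"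
    by blast
qed

section \<open>The cyclic group generated by \<open>sigma\<close>\<close>

lemma sigma_funpow_eq_id_iff: "sigma ^^ k = id \<longleftrightarrow> 31 dvd k"
proof
  assume id: "sigma ^^ k = id"
  \<comment> \<open>Both triples give the same edge when \<open>sigma ^^ k\<close> is the identity,
    so the regular orbits make the order exactly 31.\<close>
  have "(k mod 31, 0, 0) = (0 :: nat, 0 :: nat, 0 :: nat)"
    by (rule inj_onD[OF inj_on_orbit_edge])
      (auto simp: orbit_edge_def sigma_funpow_mod id params_def)
  then show "31 dvd k"
    by auto
next
  assume "31 dvd k"
  then show "sigma ^^ k = id"
    using sigma_funpow_mod[of k] by simp
qed

theorem theorem1:
  fixes F (structure)
  assumes "field F" and "order F = 32"
  shows "\<exists>(D :: (bit ^ 6) set set set) H.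
    triangle_design D \<and>
    subgroup H GL \<and>
    GL\<lparr>carrier := H\<rparr> \<cong> mult_of F \<and>
    invariant_under H D"
proof -
  interpret F: field F by fact
  interpret GL: group "GL :: (bit ^ 6 \<Rightarrow> bit ^ 6) monoid" by (rule group_GL)
  define H where "H = range (\<lambda>m. sigma ^^ m)"
  have sigma: "sigma \<in> carrier GL"
    using linear_sigma bij_sigma_funpow[of 1] by (simp add: GL_def)
  have H: "subgroup H GL"
    using subgroup_powers[OF group_GL sigma, of 31] sigma_order
    unfolding H_def nat_pow_GL by (simp add: GL_def)
  then have group_H: "group (GL\<lparr>carrier := H\<rparr>)"
    by (rule GL.subgroup_imp_group)
  have pow: "sigma [^]\<^bsub>GL\<lparr>carrier := H\<rparr>\<^esub> (k::nat) = sigma ^^ k" for k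
    by (simp add: nat_pow_def flip: nat_pow_GL)
  have carrier_H:
    "carrier (GL\<lparr>carrier := H\<rparr>) = range (\<lambda>k::nat. sigma [^]\<^bsub>GL\<lparr>carrier := H\<rparr>\<^esub> k)"
    unfolding pow by (simp add: H_def)
  have sigma_H: "sigma \<in> carrier (GL\<lparr>carrier := H\<rparr>)"
    by (auto simp: H_def intro: range_eqI[of _ _ 1])
  have ord_sigma: "group.ord (GL\<lparr>carrier := H\<rparr>) sigma = 31"
    by (subst group.ord_unique[OF group_H sigma_H])
      (simp add: pow sigma_funpow_eq_id_iff[symmetric], simp add: GL_def)

  \<comment> \<open>An infinite carrier would have \<open>card\<close> equal to 0.\<close>
  have fin: "finite (carrier F)"
    using assms(2) by (metis order_def card.infinite zero_neq_numeral)
  obtain a where a: "a \<in> carrier (mult_of F)"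
      "carrier (mult_of F) = {a [^]\<^bsub>F\<^esub> i | i::nat. i \<in> UNIV}"
    using F.finite_field_mult_group_has_gen[OF fin] by blast
  have a': "carrier (mult_of F) = range (\<lambda>k::nat. a [^]\<^bsub>mult_of F\<^esub> k)"
    using a(2) by (auto simp: nat_pow_mult_of)
  have group_F: "group (mult_of F)"
    by (rule F.field_mult_group)
  have "order (mult_of F) = 31"
    using assms(2) F.order_mult_of[OF fin] by simp
  moreover have "group.ord (mult_of F) a = order (mult_of F)"
    by (rule group.ord_generator[OF group_F a(1) a'])
  \<comment> \<open>Both groups are cyclic of order 31, generated by \<open>sigma\<close> and
    \<open>a\<close>.\<close>
  ultimately have "GL\<lparr>carrier := H\<rparr> \<cong> mult_of F"
    using ord_sigma
    by (intro cyclic_groups_iso[OF group_H group_F sigma_H a(1) carrier_H a']) simp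
  then show ?thesis
    using triangle_design_design H invariant_under_design unfolding H_def by blast
qed

end
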